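(* Let $\Phi=(G,\varphi)$ be a distance compatible $\mathbb{T}$-gain graph on a connected simple graph $G$ with $n$ vertices. Then $\rho(\mathcal{DL}(\Phi))\le 2\max_{v\in V(G)}\mathrm{Tr}(v)$, with equality if and only if $\Phi$ is switching equivalent to $(K_n,-1)$, the complete graph on $n$ vertices with every oriented edge having gain $-1$.
   Context: $\mathbb{T}=\{z\in\mathbb{C}:|z|=1\}$. A $\mathbb{T}$-gain graph $\Phi=(G,\varphi)$ assigns to each of the two orientations $\vec e_{i,j},\vec e_{j,i}$ of every edge $v_iv_j$ of $G$ a gain in $\mathbb{T}$ with $\varphi(\vec e_{j,i})=\overline{\varphi(\vec e_{i,j})}$; the gain of an oriented path is the product of the gains of its consecutive oriented edges. Two gain graphs $(G,\varphi),(G,\psi)$ on the same graph are switching equivalent if there is $\zeta:V(G)\to\mathbb{T}$ with $\varphi(\vec e_{i,j})=\zeta(v_i)^{-1}\psi(\vec e_{i,j})\zeta(v_j)$ for every edge. $d(u,v)$ is the shortest-path distance in $G$ and $\mathrm{Tr}(v)=\sum_{u\in V(G)}d(v,u)$ is the transmission of $v$. For a total order $<$ and $s<t$, $\varphi^{<}_{\max}(s,t)$ (resp. $\varphi^{<}_{\min}(s,t)$) is the maximum (resp. minimum) of the gains of all shortest oriented paths from $s$ to $t$, with respect to the lexicographic order on $\mathbb{C}$ ($a+ib\le c+id$ iff $a<c$, or $a=c$ and $b\le d$); further $\varphi^{<}_{\max}(t,s)=\overline{\varphi^{<}_{\max}(s,t)}$, $\varphi^{<}_{\min}(t,s)=\overline{\varphi^{<}_{\min}(s,t)}$,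 and both vanish on pairs $(s,s)$. $\mathcal{D}^{\max}_{<}(\Phi)=(\varphi^{<}_{\max}(v_i,v_j)d(v_i,v_j))_{i,j}$, $\mathcal{D}^{\min}_{<}(\Phi)=(\varphi^{<}_{\min}(v_i,v_j)d(v_i,v_j))_{i,j}$. $\Phi$ is distance compatible if $\mathcal{D}^{\max}_{<}(\Phi)=\mathcal{D}^{\min}_{<}(\Phi)$ for the standard order $v_1<\dots<v_n$; the common matrix is $\mathcal{D}(\Phi)$, and $\mathcal{DL}(\Phi)=\mathrm{Tr}(G)-\mathcal{D}(\Phi)$ with $\mathrm{Tr}(G)=\mathrm{diag}(\mathrm{Tr}(v_1),\dots,\mathrm{Tr}(v_n))$. $\rho(M)$ denotes the spectral radius of $M$. *)

theory Defs
  imports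
    "Graph_Theory.Graph_Theory"
    "Jordan_Normal_Form.Spectral_Radius"
begin

(* A finite simple graph is a symmetric loop-free pair digraph; an edge v_i v_j is the pair of
   arcs (i, j), (j, i), which are its two orientations.  Only the values of the gain function on
   arcs of G are meaningful. *)
locale gain_graph = pair_graph G for G :: "'v pair_pre_digraph" +
  fixes \<phi> :: "'v \<times> 'v \<Rightarrow> complex"
  assumes gain_unit: "(u, v) \<in> parcs G \<Longrightarrow> cmod (\<phi> (u, v)) = 1"
    and gain_rev: "(u, v) \<in> parcs G \<Longrightarrow> \<phi> (v, u) = cnj (\<phi> (u, v))"

definition path_gain :: "('v \<times> 'v \<Rightarrow> complex) \<Rightarrow> ('v \<times> 'v) awalk \<Rightarrow> complex" where
  "path_gain \<phi> p = prod_list (map \<phi> p)"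

definition switching_equivalent ::
  "'v pair_pre_digraph \<Rightarrow> ('v \<times> 'v \<Rightarrow> complex) \<Rightarrow>
   'v pair_pre_digraph \<Rightarrow> ('v \<times> 'v \<Rightarrow> complex) \<Rightarrow> bool" where
  "switching_equivalent G \<phi> H \<psi> \<longleftrightarrow> G = H \<and>
     (\<exists>\<zeta> :: 'v \<Rightarrow> complex. (\<forall>v \<in> pverts G. cmod (\<zeta> v) = 1) \<and>
        (\<forall>(u, v) \<in> parcs G. \<phi> (u, v) = inverse (\<zeta> u) * \<psi> (u, v) * \<zeta> v))"

definition gdist :: "'v pair_pre_digraph \<Rightarrow> 'v \<Rightarrow> 'v \<Rightarrow> nat" where
  "gdist G u v = (LEAST k. \<exists>p. pre_digraph.apath (with_proj G) u p v \<and> length p = k)"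

definition transmission :: "'v pair_pre_digraph \<Rightarrow> 'v \<Rightarrow> nat" where
  "transmission G v = (\<Sum>u \<in> pverts G. gdist G v u)"

definition shortest_path_gains ::
  "'v pair_pre_digraph \<Rightarrow> ('v \<times> 'v \<Rightarrow> complex) \<Rightarrow> 'v \<Rightarrow> 'v \<Rightarrow> complex set" where
  "shortest_path_gains G \<phi> s t =
     {path_gain \<phi> p | p. pre_digraph.apath (with_proj G) s p t \<and> length p = gdist G s t}"

definition clex_le :: "complex \<Rightarrow> complex \<Rightarrow> bool" where
  "clex_le z w \<longleftrightarrow> Re z < Re w \<or> Re z = Re w \<and> Im z \<le> Im w"

definition clex_Max :: "complex set \<Rightarrow> complex" where
  "clex_Max S = (THE m. m \<in> S \<and> (\<forall>z \<in> S. clex_le z m))"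

definition clex_Min :: "complex set \<Rightarrow> complex" where
  "clex_Min S = (THE m. m \<in> S \<and> (\<forall>z \<in> S. clex_le m z))"

lemma clex_le_antisym: "clex_le z w \<Longrightarrow> clex_le w z \<Longrightarrow> z = w"
  by (auto simp: clex_le_def complex_eq_iff)

lemma clex_Max_eqI: "m \<in> S \<Longrightarrow> (\<And>z. z \<in> S \<Longrightarrow> clex_le z m) \<Longrightarrow> clex_Max S = m"
  unfolding clex_Max_def by (rule the_equality) (auto intro: clex_le_antisym)

lemma clex_Min_eqI: "m \<in> S \<Longrightarrow> (\<And>z. z \<in> S \<Longrightarrow> clex_le m z) \<Longrightarrow> clex_Min S = m"
  unfolding clex_Min_def by (rule the_equality) (auto intro: clex_le_antisym)

lemma clex_Max_properties:
  assumes "finite S" "S \<noteq> {}"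
  shows "clex_Max S \<in> S \<and> (\<forall>z \<in> S. clex_le z (clex_Max S))"
proof -
  have "\<exists>m \<in> S. \<forall>z \<in> S. clex_le z m"
    using assms by (induction rule: finite_ne_induct) (auto simp: clex_le_def, force+)
  then show ?thesis using clex_Max_eqI by metis
qed

lemma clex_Min_properties:
  assumes "finite S" "S \<noteq> {}"
  shows "clex_Min S \<in> S \<and> (\<forall>z \<in> S. clex_le (clex_Min S) z)"
proof -
  have "\<exists>m \<in> S. \<forall>z \<in> S. clex_le m z"
    using assms by (induction rule: finite_ne_induct) (auto simp: clex_le_def, force+)
  then show ?thesis using clex_Min_eqI by metis
qed

(* lt is the strict part of a total order on the vertices. *)
definition gain_max ::
  "('v \<Rightarrow> 'v \<Rightarrow> bool) \<Rightarrow> 'v pair_pre_digraph \<Rightarrow> ('v \<times> 'v \<Rightarrow> complex) \<Rightarrow> 'v \<Rightarrow> 'v \<Rightarrow> complex" where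
  "gain_max lt G \<phi> s t =
     (if lt s t then clex_Max (shortest_path_gains G \<phi> s t)
      else if lt t s then cnj (clex_Max (shortest_path_gains G \<phi> t s))
      else 0)"

definition gain_min ::
  "('v \<Rightarrow> 'v \<Rightarrow> bool) \<Rightarrow> 'v pair_pre_digraph \<Rightarrow> ('v \<times> 'v \<Rightarrow> complex) \<Rightarrow> 'v \<Rightarrow> 'v \<Rightarrow> complex" where
  "gain_min lt G \<phi> s t =
     (if lt s t then clex_Min (shortest_path_gains G \<phi> s t)
      else if lt t s then cnj (clex_Min (shortest_path_gains G \<phi> t s))
      else 0)"

(* From here on the vertex set is {0..<n} with n = card (pverts G): vertex i is the one usually
   called v_(i+1), it indexes row and column i, and the standard order is the order of nat. *)
definition dist_mat_max ::
  "(nat \<Rightarrow> nat \<Rightarrow> bool) \<Rightarrow> nat pair_pre_digraph \<Rightarrow> (nat \<times> nat \<Rightarrow> complex) \<Rightarrow> complex mat" where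
  "dist_mat_max lt G \<phi> = mat (card (pverts G)) (card (pverts G))
     (\<lambda>(i, j). gain_max lt G \<phi> i j * of_nat (gdist G i j))"

definition dist_mat_min ::
  "(nat \<Rightarrow> nat \<Rightarrow> bool) \<Rightarrow> nat pair_pre_digraph \<Rightarrow> (nat \<times> nat \<Rightarrow> complex) \<Rightarrow> complex mat" where
  "dist_mat_min lt G \<phi> = mat (card (pverts G)) (card (pverts G))
     (\<lambda>(i, j). gain_min lt G \<phi> i j * of_nat (gdist G i j))"

definition distance_compatible :: "nat pair_pre_digraph \<Rightarrow> (nat \<times> nat \<Rightarrow> complex) \<Rightarrow> bool" where
  "distance_compatible G \<phi> \<longleftrightarrow> dist_mat_max (<) G \<phi> = dist_mat_min (<) G \<phi>"

(* Meaningful for distance compatible gain graphs, where it is the common value of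
   dist_mat_max and dist_mat_min. *)
definition dist_mat :: "nat pair_pre_digraph \<Rightarrow> (nat \<times> nat \<Rightarrow> complex) \<Rightarrow> complex mat" where
  "dist_mat G \<phi> = dist_mat_max (<) G \<phi>"

definition transmission_mat :: "nat pair_pre_digraph \<Rightarrow> complex mat" where
  "transmission_mat G = mat (card (pverts G)) (card (pverts G))
     (\<lambda>(i, j). if i = j then of_nat (transmission G i) else 0)"

definition dist_laplacian :: "nat pair_pre_digraph \<Rightarrow> (nat \<times> nat \<Rightarrow> complex) \<Rightarrow> complex mat" where
  "dist_laplacian G \<phi> = transmission_mat G - dist_mat G \<phi>"

definition complete_pair_graph :: "nat \<Rightarrow> nat pair_pre_digraph" where
  "complete_pair_graph n = \<lparr>pverts = {0..<n}, parcs = {(i, j). i < n \<and> j < n \<and> i \<noteq> j}\<rparr>"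

lemma complete_digraph_complete_pair_graph:
  "complete_digraph n (with_proj (complete_pair_graph n))"
  by (auto simp: complete_digraph_pair_def complete_pair_graph_def)

lemma gain_graph_complete_minus_one: "gain_graph (complete_pair_graph n) (\<lambda>_. -1)"
proof -
  interpret pair_graph "complete_pair_graph n"
    by (rule pair_graphI_complete[OF complete_digraph_complete_pair_graph])
  show ?thesis by unfold_locales auto
qed

end

theory Submission
  imports Defs
begin

text \<open>
  Row \<open>i\<close> of the distance matrix has absolute row sum \<open>Tr(v\<^sub>i)\<close>, so Gershgorin's argument, applied
  at an entry of maximal modulus of an eigenvector \<open>x\<close>, bounds the spectral radius by twice the
  maximal transmission. In the case of equality every triangle inequality used is tight. This
  forces all entries of \<open>x\<close> to have the same modulus, hence the argument applies to every row, and
  \<open>\<phi>(i, j) x\<^sub>j = -x\<^sub>i\<close> for the common gain of the shortest paths between any two distinct vertices.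
  Two vertices at distance two would then be joined by a shortest path of gain
  \<open>(-x\<^sub>i / x\<^sub>k) (-x\<^sub>k / x\<^sub>j) = x\<^sub>i / x\<^sub>j\<close>, a contradiction; so the graph is complete and \<open>x\<close> provides
  the switching function.
\<close>

section \<open>The equality case of Gershgorin's bound\<close>

lemma complex_eq_of_real_if_Re_ge:
  assumes "norm z \<le> r" "r \<le> Re z"
  shows "z = of_real r"
proof -
  have "Re z = r" "norm z = r"
    using assms complex_Re_le_cmod[of z] by linarith+
  then have "(Im z)\<^sup>2 = 0"
    using cmod_power2[of z] by simp
  with \<open>Re z = r\<close> show ?thesis by (simp add: complex_eq_iff)
qed

text \<open>Equality in the triangle inequality: each \<open>Re (c j)\<close> is at most
  \<open>r j\<close> and the sums agree, so every real part attains its bound and no room is left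
  for an imaginary part.\<close>

lemma sum_complex_eq_sum_bounds:
  fixes c :: "'a \<Rightarrow> complex"
  assumes "finite S" and bound: "\<And>j. j \<in> S \<Longrightarrow> norm (c j) \<le> r j"
    and eq: "(\<Sum>j\<in>S. c j) = of_real (\<Sum>j\<in>S. r j)" and "j \<in> S"
  shows "c j = of_real (r j)"
proof (rule complex_eq_of_real_if_Re_ge)
  have le: "Re (c i) \<le> r i" if "i \<in> S" for i
    using bound[OF that] complex_Re_le_cmod[of "c i"] by linarith
  have "(\<Sum>j\<in>S. Re (c j)) = (\<Sum>j\<in>S. r j)"
    using arg_cong[OF eq, of Re] by simp
  then show "r j \<le> Re (c j)"
    using sum_mono_inv[of "\<lambda>j. Re (c j)" S r j] le assms(1,4) by simp
qed (use assms in auto)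

text \<open>Expanding the square gives 4t^2 = t^2 + 2t Re s + |s|^2 with |s| \<le> t, hence Re s
  \<ge> t once t > 0 is cancelled.\<close>

lemma norm_of_real_add_eq_double:
  fixes s :: complex
  assumes "norm s \<le> t" "norm (of_real t + s) = 2 * t"
  shows "s = of_real t"
proof (cases "t = 0")
  case False
  with assms have "t > 0" using norm_ge_zero[of s] by linarith
  have "(norm (of_real t + s))\<^sup>2 = t\<^sup>2 + 2 * t * Re s + (norm s)\<^sup>2"
    unfolding cmod_power2 by (simp add: power2_eq_square algebra_simps)
  moreover have "(norm s)\<^sup>2 \<le> t\<^sup>2"
    using assms(1) by (simp add: power_mono)
  ultimately have "t * t \<le> t * Re s"
    using assms(2) by (simp add: power2_eq_square)
  with \<open>t > 0\<close> have "t \<le> Re s" by simp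
  with assms(1) show ?thesis by (rule complex_eq_of_real_if_Re_ge)
qed (use assms in auto)

text \<open>Dividing the row equation by \<open>z\<close> writes \<open>\<mu>\<close> as
  \<open>t\<close> plus terms of modulus at most \<open>norm (d j)\<close>. The dominating entry
  \<open>z\<close> is kept apart from \<open>x\<close> so that any single row can be
  treated.\<close>

lemma gershgorin_row:
  fixes x d :: "'a \<Rightarrow> complex" and z \<mu> :: complex and t :: real
  assumes fin: "finite S"
    and row: "\<mu> * z = of_real t * z - (\<Sum>j\<in>S. d j * x j)"
    and t: "(\<Sum>j\<in>S. norm (d j)) = t"
    and dom: "\<And>j. j \<in> S \<Longrightarrow> norm (x j) \<le> norm z" and z: "z \<noteq> 0"
  shows "norm \<mu> \<le> 2 * t"
    and "norm \<mu> = 2 * t \<Longrightarrow> j \<in> S \<Longrightarrow> d j * x j = - of_real (norm (d j)) * z"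
proof -
  define c where "c j = - (d j * x j / z)" for j
  have c: "norm (c j) \<le> norm (d j)" if "j \<in> S" for j
  proof -
    have "norm (c j) = norm (d j) * (norm (x j) / norm z)"
      by (simp add: c_def norm_mult norm_divide)
    also have "\<dots> \<le> norm (d j) * 1"
      using dom[OF that] z by (intro mult_left_mono) (auto simp: divide_simps)
    finally show ?thesis by simp
  qed
  have "\<mu> = of_real t - (\<Sum>j\<in>S. d j * x j) / z"
    using row z by (simp add: field_simps)
  then have lam: "\<mu> = of_real t + (\<Sum>j\<in>S. c j)"
    by (simp add: c_def sum_negf sum_divide_distrib)
  have s: "norm (\<Sum>j\<in>S. c j) \<le> t"
    using sum_norm_le[of S c "\<lambda>j. norm (d j)"] c t by auto
  have "t \<ge> 0" using s norm_ge_zero[of "\<Sum>j\<in>S. c j"] by linarith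
  then show "norm \<mu> \<le> 2 * t"
    using norm_triangle_ineq[of "of_real t" "\<Sum>j\<in>S. c j"] s unfolding lam by simp
  assume "norm \<mu> = 2 * t" "j \<in> S"
  then have "(\<Sum>j\<in>S. c j) = of_real (\<Sum>j\<in>S. norm (d j))"
    using norm_of_real_add_eq_double[OF s] lam t by simp
  from sum_complex_eq_sum_bounds[OF fin c this \<open>j \<in> S\<close>]
  have "c j = of_real (norm (d j))" by simp
  then have "d j * x j / z = - of_real (norm (d j))"
    unfolding c_def by (metis minus_minus)
  with z show "d j * x j = - of_real (norm (d j)) * z"
    by (simp add: divide_eq_eq)
qed

section \<open>Eigenvectors of entrywise given matrices, and the bound for matrices of Laplacian
  type\<close>

lemma eigenvector_matD:
  assumes "eigenvector (mat n n f) v \<mu>"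
  shows "i < n \<Longrightarrow> \<mu> * v $ i = (\<Sum>j<n. f (i, j) * v $ j)"
    and "\<exists>i<n. v $ i \<noteq> 0"
proof -
  have v: "dim_vec v = n" "v \<noteq> 0\<^sub>v n" and e: "mat n n f *\<^sub>v v = \<mu> \<cdot>\<^sub>v v"
    using assms unfolding eigenvector_def carrier_vec_def dim_row_mat mem_Collect_eq by blast+
  show "\<exists>i<n. v $ i \<noteq> 0" using v eq_vecI[of v "0\<^sub>v n"] by (metis index_zero_vec)
  assume "i < n"
  then have "(mat n n f *\<^sub>v v) $ i = (\<Sum>j<n. f (i, j) * v $ j)"
    using v by (simp add: scalar_prod_def lessThan_atLeast0)
  then show "\<mu> * v $ i = (\<Sum>j<n. f (i, j) * v $ j)"
    using e v \<open>i < n\<close> by simp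
qed

lemma eigenvector_matI:
  assumes "n > 0" "\<And>i. i < n \<Longrightarrow> x i \<noteq> 0"
    and "\<And>i. i < n \<Longrightarrow> (\<Sum>j<n. f (i, j) * x j) = \<mu> * x i"
  shows "eigenvector (mat n n f) (vec n x) \<mu>"
proof -
  have "vec n x $ 0 \<noteq> 0\<^sub>v n $ 0" using assms(1,2) by simp
  moreover have "mat n n f *\<^sub>v vec n x = \<mu> \<cdot>\<^sub>v vec n x"
    by (rule eq_vecI) (use assms(3) in \<open>simp_all add: scalar_prod_def lessThan_atLeast0\<close>)
  ultimately show ?thesis unfolding eigenvector_def by fastforce
qed

lemma laplacian_type_eigenvalue:
  fixes d :: "nat \<Rightarrow> nat \<Rightarrow> complex" and t :: "nat \<Rightarrow> real"
  assumes ev: "eigenvector (mat n n (\<lambda>(i, j). (if i = j then of_real (t i) else 0) - d i j)) v \<mu>"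
    and t: "\<And>i. i < n \<Longrightarrow> (\<Sum>j<n. norm (d i j)) = t i"
    and T: "\<And>i. i < n \<Longrightarrow> t i \<le> T"
  shows "norm \<mu> \<le> 2 * T"
    and "norm \<mu> = 2 * T \<Longrightarrow> (\<And>i j. i < n \<Longrightarrow> j < n \<Longrightarrow> i \<noteq> j \<Longrightarrow> d i j \<noteq> 0) \<Longrightarrow>
      i < n \<Longrightarrow> j < n \<Longrightarrow> v $ i \<noteq> 0 \<and> d i j * v $ j = - of_real (norm (d i j)) * v $ i"
proof -
  have row: "\<mu> * v $ k = of_real (t k) * v $ k - (\<Sum>j<n. d k j * v $ j)" if "k < n" for k
  proof -
    have "(\<Sum>j<n. ((if k = j then of_real (t k) else 0) - d k j) * v $ j) =
      (\<Sum>j<n. if k = j then of_real (t k) * v $ k else 0) - (\<Sum>j<n. d k j * v $ j)"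
      unfolding sum_subtractf[symmetric] by (rule sum.cong) (auto simp: algebra_simps)
    then show ?thesis
      using eigenvector_matD(1)[OF ev that] that by simp
  qed
  obtain k0 where k0: "k0 < n" "v $ k0 \<noteq> 0" using eigenvector_matD(2)[OF ev] by auto
  have "Max ((\<lambda>j. norm (v $ j)) ` {..<n}) \<in> (\<lambda>j. norm (v $ j)) ` {..<n}"
    using k0 by (intro Max_in) auto
  then obtain k where k: "k < n" and Max: "norm (v $ k) = Max ((\<lambda>j. norm (v $ j)) ` {..<n})"
    by force
  have dom: "norm (v $ j) \<le> norm (v $ k)" if "j < n" for j
    unfolding Max using that by (intro Max_ge) auto
  have nz: "v $ k \<noteq> 0" using dom[OF k0(1)] k0(2) by auto
  have kb: "norm \<mu> \<le> 2 * t k"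
    by (rule gershgorin_row(1)[OF finite_lessThan row t]) (use k dom nz in auto)
  then show "norm \<mu> \<le> 2 * T" using T[OF k] by linarith
  assume eq: "norm \<mu> = 2 * T"
    and off: "\<And>i j. i < n \<Longrightarrow> j < n \<Longrightarrow> i \<noteq> j \<Longrightarrow> d i j \<noteq> 0"
    and ij: "i < n" "j < n"
  have keq: "norm \<mu> = 2 * t k" using kb eq T[OF k] by linarith
  \<comment> \<open>Tightness of row \<open>k\<close> compares the moduli of its terms; the nonzero
    factor \<open>d k j\<close> cancels.\<close>
  have same: "norm (v $ j) = norm (v $ k)" if "j < n" for j
  proof (cases "j = k")
    case False
    have "d k j * v $ j = - of_real (norm (d k j)) * v $ k"
      by (rule gershgorin_row(2)[OF finite_lessThan row t]) (use k dom nz keq that in auto)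
    then have "norm (d k j) * norm (v $ j) = norm (d k j) * norm (v $ k)"
      by (metis norm_minus_cancel norm_mult norm_of_real abs_norm_cancel)
    then show ?thesis using off[OF k that] False by auto
  qed simp
  have nzi: "v $ i \<noteq> 0" using same[OF ij(1)] nz by auto
  \<comment> \<open>Now every entry has maximal modulus, so row \<open>i\<close> also gives a bound,
    and 2T = |\<mu>| \<le> 2 t i \<le> 2T makes that row tight too.\<close>
  have "norm \<mu> \<le> 2 * t i"
    by (rule gershgorin_row(1)[OF finite_lessThan row t]) (use ij same nzi in auto)
  with eq T[OF ij(1)] have ieq: "norm \<mu> = 2 * t i" by linarith
  have "d i j * v $ j = - of_real (norm (d i j)) * v $ i"
    by (rule gershgorin_row(2)[OF finite_lessThan row t]) (use ij same nzi ieq in auto)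
  with nzi show "v $ i \<noteq> 0 \<and> d i j * v $ j = - of_real (norm (d i j)) * v $ i" by simp
qed

section \<open>Gains of shortest paths\<close>

lemma gdist_le: "pre_digraph.apath (with_proj G) u p v \<Longrightarrow> gdist G u v \<le> length p"
  unfolding gdist_def by (rule Least_le) auto

lemma gdist_attained:
  assumes "pre_digraph.apath (with_proj G) u p v"
  shows "\<exists>q. pre_digraph.apath (with_proj G) u q v \<and> length q = gdist G u v"
  unfolding gdist_def by (rule LeastI_ex) (use assms in blast)

context gain_graph
begin

lemma gdist_self: "v \<in> pverts G \<Longrightarrow> gdist G v v = 0"
  using gdist_le[of G v "[]" v] by (simp add: apath_Nil_iff)

lemma gdist_pos:
  assumes "u \<rightarrow>\<^sup>*\<^bsub>with_proj G\<^esub> v" "u \<noteq> v"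
  shows "gdist G u v > 0"
proof -
  obtain q where "apath u q v" "length q = gdist G u v"
    using assms(1) gdist_attained by (metis reachable_apath)
  with assms(2) show ?thesis by (cases q) (auto simp: apath_Nil_iff)
qed

text \<open>Finiteness, with nonemptiness below, ensures that \<open>clex_Max\<close> and
  \<open>clex_Min\<close> pick genuine gains of shortest paths.\<close>

lemma finite_shortest_path_gains: "finite (shortest_path_gains G \<phi> s t)"
proof -
  have "shortest_path_gains G \<phi> s t \<subseteq> path_gain \<phi> ` {p. apath s p t}"
    by (auto simp: shortest_path_gains_def)
  then show ?thesis using apaths_finite finite_surj by blast
qed

lemma shortest_path_gains_nonempty:
  assumes "s \<rightarrow>\<^sup>*\<^bsub>with_proj G\<^esub> t"
  shows "shortest_path_gains G \<phi> s t \<noteq> {}"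
  using assms gdist_attained by (fastforce simp: reachable_apath shortest_path_gains_def)

lemma norm_path_gain:
  assumes "set p \<subseteq> parcs G"
  shows "norm (path_gain \<phi> p) = 1"
  using assms by (induction p) (auto simp: path_gain_def norm_mult gain_unit)

lemma norm_shortest_path_gains: "g \<in> shortest_path_gains G \<phi> s t \<Longrightarrow> norm g = 1"
  by (auto simp: shortest_path_gains_def apath_def awalk_def intro: norm_path_gain)

lemma reachable_if_connected:
  assumes "Digraph_Component.connected (with_proj G)" "u \<in> pverts G" "v \<in> pverts G"
  shows "u \<rightarrow>\<^sup>*\<^bsub>with_proj G\<^esub> v"
  using symmetric_connected_imp_strongly_connected[OF pair_sym_arcs assms(1)] assms(2,3)
  by (auto simp: strongly_connected_def)

lemma arc_shortest_path_gain:
  assumes "(u, v) \<in> parcs G"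
  shows "gdist G u v = 1" "\<phi> (u, v) \<in> shortest_path_gains G \<phi> u v"
proof -
  have ne: "u \<noteq> v" using assms by (rule no_loops')
  have p: "apath u [(u, v)] v"
    using assms ne by (auto simp: apath_simps wellformed')
  then have "u \<rightarrow>\<^sup>*\<^bsub>with_proj G\<^esub> v" by (auto simp: reachable_apath)
  then show d: "gdist G u v = 1"
    using gdist_pos[of u v] ne gdist_le[OF p] by simp
  show "\<phi> (u, v) \<in> shortest_path_gains G \<phi> u v"
    unfolding shortest_path_gains_def
    by (auto simp: d path_gain_def intro!: exI[of _ "[(u, v)]"] p)
qed

text \<open>The path through \<open>v\<close> is shortest: length 0 is excluded by
  \<open>u \<noteq> w\<close>, length 1 by the missing arc.\<close>

lemma distance_two_shortest_path_gain:
  assumes uv: "(u, v) \<in> parcs G" and vw: "(v, w) \<in> parcs G"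
    and ne: "u \<noteq> w" and na: "(u, w) \<notin> parcs G"
  shows "\<phi> (u, v) * \<phi> (v, w) \<in> shortest_path_gains G \<phi> u w"
proof -
  have p: "apath u [(u, v), (v, w)] w"
    using uv vw ne by (auto simp: apath_simps wellformed' dest: no_loops')
  have "gdist G u w \<noteq> 0" "gdist G u w \<noteq> 1"
  proof -
    obtain q where q: "apath u q w" "length q = gdist G u w"
      using gdist_attained[OF p] by auto
    show "gdist G u w \<noteq> 0" using q ne by (cases q) (auto simp: apath_Nil_iff)
    show "gdist G u w \<noteq> 1"
    proof
      assume "gdist G u w = 1"
      then obtain e where "q = [e]" using q(2) by (auto simp: length_Suc_conv)
      then show False using q(1) na by (cases e) (auto simp: apath_simps)
    qed
  qed
  then have d: "gdist G u w = 2" using gdist_le[OF p] by simp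
  show ?thesis
    unfolding shortest_path_gains_def
    by (auto simp: d path_gain_def intro!: exI[of _ "[(u, v), (v, w)]"] p)
qed

text \<open>Induction along a walk: each further arc is absorbed by transitivity, unless it returns
  to the start.\<close>

lemma adjacent_if_no_distance_two:
  assumes "u \<rightarrow>\<^sup>*\<^bsub>with_proj G\<^esub> v"
    and "\<And>a b c. (a, b) \<in> parcs G \<Longrightarrow> (b, c) \<in> parcs G \<Longrightarrow> a \<noteq> c \<Longrightarrow> (a, c) \<in> parcs G"
  shows "u = v \<or> (u, v) \<in> parcs G"
  using assms(1)
proof (induction rule: reachable_induct)
  case (step x y)
  then show ?case using assms(2) by auto
qed simp

end

section \<open>Distance compatible gain graphs: the common gain and the distance matrix\<close>

locale compatible_gain_graph = gain_graph G \<phi>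
  for G :: "nat pair_pre_digraph" and \<phi> +
  fixes n :: nat
  assumes verts: "pverts G = {0..<n}"
    and conn: "Digraph_Component.connected (with_proj G)"
    and compat: "distance_compatible G \<phi>"
begin

lemma reach: "u < n \<Longrightarrow> v < n \<Longrightarrow> u \<rightarrow>\<^sup>*\<^bsub>with_proj G\<^esub> v"
  using reachable_if_connected[OF conn] verts by auto

text \<open>Connectedness includes having a vertex; this keeps the spectrum and the set of
  transmissions nonempty.\<close>

lemma n_pos: "n > 0"
  using symmetric_connected_imp_strongly_connected[OF pair_sym_arcs conn] verts
  by (auto simp: strongly_connected_def)

lemma arc_bounds: "(u, v) \<in> parcs G \<Longrightarrow> u < n \<and> v < n"
  using wellformed' verts by fastforce

abbreviation gain :: "nat \<Rightarrow> nat \<Rightarrow> complex" where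
  "gain \<equiv> gain_max (<) G \<phi>"

text \<open>Any gain lies lexicographically between the minimum and the maximum, and compatibility
  makes these coincide: the matrix entries agree and the positive distance cancels.\<close>

lemma gain_eq_shortest_path_gain:
  assumes "s < t" "t < n" and g: "g \<in> shortest_path_gains G \<phi> s t"
  shows "gain s t = g"
proof -
  let ?S = "shortest_path_gains G \<phi> s t"
  have "gdist G s t > 0" using gdist_pos reach assms by simp
  moreover have "dist_mat_max (<) G \<phi> $$ (s, t) = dist_mat_min (<) G \<phi> $$ (s, t)"
    using compat by (simp add: distance_compatible_def)
  ultimately have "clex_Max ?S = clex_Min ?S"
    using assms(1,2) verts
    by (simp add: dist_mat_max_def dist_mat_min_def gain_max_def gain_min_def)
  moreover have "clex_le g (clex_Max ?S)" "clex_le (clex_Min ?S) g"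
    using clex_Max_properties[OF finite_shortest_path_gains, of s t]
      clex_Min_properties[OF finite_shortest_path_gains, of s t] g by auto
  ultimately show ?thesis
    using clex_le_antisym[of g "clex_Max ?S"] assms(1) by (simp add: gain_max_def)
qed

lemma gain_arc:
  assumes "(u, v) \<in> parcs G"
  shows "gain u v = \<phi> (u, v)"
proof (cases "u < v")
  case True
  then show ?thesis
    using gain_eq_shortest_path_gain arc_shortest_path_gain(2) arc_bounds assms by blast
next
  case False
  then have "v < u" using no_loops'[OF assms] by simp
  moreover have vu: "(v, u) \<in> parcs G" using assms by (rule arcs_symmetric)
  ultimately have "gain v u = \<phi> (v, u)"
    using gain_eq_shortest_path_gain arc_shortest_path_gain(2) arc_bounds by blast
  then show ?thesis using \<open>v < u\<close> gain_rev[OF vu] by (simp add: gain_max_def)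
qed

lemma norm_gain:
  assumes "i < n" "j < n" "i \<noteq> j"
  shows "norm (gain i j) = 1"
proof -
  have "norm (clex_Max (shortest_path_gains G \<phi> s t)) = 1" if "s < n" "t < n" for s t
    using clex_Max_properties[OF finite_shortest_path_gains shortest_path_gains_nonempty]
      norm_shortest_path_gains reach that by blast
  then show ?thesis using assms by (auto simp: gain_max_def)
qed

text \<open>The entries of \<open>dist_mat\<close> as a function, which brings
  \<open>dist_laplacian\<close> into the shape of \<open>laplacian_type_eigenvalue\<close>.\<close>

definition D :: "nat \<Rightarrow> nat \<Rightarrow> complex" where
  "D i j = gain i j * of_nat (gdist G i j)"

text \<open>Unit gains leave only the distance, and on the diagonal both sides vanish; hence
  absolute row sums are transmissions.\<close>

lemma norm_D:
  assumes "i < n" "j < n"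
  shows "norm (D i j) = real (gdist G i j)"
  using norm_gain[OF assms] gdist_self[of i] assms verts
  by (cases "i = j") (auto simp: D_def norm_mult)

lemma D_nonzero: "i < n \<Longrightarrow> j < n \<Longrightarrow> i \<noteq> j \<Longrightarrow> D i j \<noteq> 0"
  using norm_D gdist_pos reach by (metis norm_zero of_nat_0_eq_iff less_irrefl)

lemma D_arc: "(u, v) \<in> parcs G \<Longrightarrow> D u v = \<phi> (u, v)"
  by (simp add: D_def gain_arc arc_shortest_path_gain(1))

lemma dist_laplacian_eq: "dist_laplacian G \<phi> =
  mat n n (\<lambda>(i, j). (if i = j then of_real (real (transmission G i)) else 0) - D i j)"
  by (rule eq_matI)
    (auto simp: dist_laplacian_def transmission_mat_def dist_mat_def dist_mat_max_def D_def verts)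

lemma sum_norm_D: "i < n \<Longrightarrow> (\<Sum>j<n. norm (D i j)) = real (transmission G i)"
  by (simp add: transmission_def verts norm_D lessThan_atLeast0)

section \<open>The bound on the spectral radius\<close>

abbreviation T :: real where
  "T \<equiv> real (Max (transmission G ` pverts G))"

lemma transmission_le_T: "i < n \<Longrightarrow> real (transmission G i) \<le> T"
  using verts by simp

lemma dist_laplacian_carrier: "dist_laplacian G \<phi> \<in> carrier_mat n n"
  by (simp add: dist_laplacian_eq)

lemma spectral_radius_attained:
  obtains v \<mu> where "eigenvector (dist_laplacian G \<phi>) v \<mu>"
    and "norm \<mu> = spectral_radius (dist_laplacian G \<phi>)"
  using spectral_radius_mem_max(1)[OF dist_laplacian_carrier n_pos]
  by (force simp: spectrum_def eigenvalue_def)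

lemma spectral_radius_le: "spectral_radius (dist_laplacian G \<phi>) \<le> 2 * T"
proof -
  obtain v \<mu> where ev: "eigenvector (dist_laplacian G \<phi>) v \<mu>"
    and mu: "norm \<mu> = spectral_radius (dist_laplacian G \<phi>)"
    by (rule spectral_radius_attained)
  show ?thesis
    unfolding mu[symmetric]
    by (rule laplacian_type_eigenvalue(1)[OF ev[unfolded dist_laplacian_eq] sum_norm_D
          transmission_le_T])
qed

section \<open>Equality forces a complete graph whose gain is -1 up to switching\<close>

lemma switching_equivalent_if_extremal:
  assumes "spectral_radius (dist_laplacian G \<phi>) = 2 * T"
  shows "switching_equivalent G \<phi> (complete_pair_graph n) (\<lambda>_. -1)"
proof -
  obtain v \<mu> where ev: "eigenvector (dist_laplacian G \<phi>) v \<mu>" and mu: "norm \<mu> = 2 * T"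
    using assms spectral_radius_attained by metis
  have extremal: "v $ i \<noteq> 0 \<and> D i j * v $ j = - of_real (norm (D i j)) * v $ i"
    if "i < n" "j < n" for i j
    using laplacian_type_eigenvalue(2)[OF ev[unfolded dist_laplacian_eq] sum_norm_D
        transmission_le_T mu D_nonzero that] by simp
  have nz: "v $ i \<noteq> 0" if "i < n" for i using extremal[OF that that] by simp
  \<comment> \<open>Both sides of the extremal relation carry the factor \<open>gdist G i j\<close>,
    which is positive for distinct vertices.\<close>
  have gain: "gain i j * v $ j = - v $ i" if "i < n" "j < n" "i \<noteq> j" for i j
  proof -
    have "of_nat (gdist G i j) * (gain i j * v $ j) = of_nat (gdist G i j) * (- v $ i)"
      using extremal[OF that(1,2)] norm_D[OF that(1,2)] by (simp add: D_def algebra_simps)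
    moreover have "gdist G i j > 0" using gdist_pos reach that by simp
    ultimately show ?thesis by (metis mult_left_cancel of_nat_eq_0_iff less_irrefl)
  qed
  have phi: "\<phi> (a, b) = - v $ a / v $ b" if "(a, b) \<in> parcs G" for a b
    using gain[of a b] gain_arc[OF that] arc_bounds[OF that] no_loops'[OF that] nz[of b]
    by (simp add: field_simps)
  \<comment> \<open>A shortest path of length two would have gain \<open>v $ a / v $ c\<close>, of the wrong sign.\<close>
  have no_two: False if "a < c" "(a, b) \<in> parcs G" "(b, c) \<in> parcs G" "(a, c) \<notin> parcs G" for a b c
  proof -
    have bd: "a < n" "b < n" "c < n" using arc_bounds that by auto
    have "gain a c = \<phi> (a, b) * \<phi> (b, c)"
      using that bd by (intro gain_eq_shortest_path_gain distance_two_shortest_path_gain) auto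
    also have "\<dots> = v $ a / v $ c" using nz bd by (simp add: phi that)
    finally have "v $ a = - v $ a" using gain[of a c] bd that nz[of c] by simp
    then show False using nz[OF bd(1)] by simp
  qed
  \<comment> \<open>\<open>no_two\<close> covers increasing end vertices only; otherwise the path is
    reversed by symmetry of the arcs.\<close>
  have trans: "(a, c) \<in> parcs G" if "(a, b) \<in> parcs G" "(b, c) \<in> parcs G" "a \<noteq> c" for a b c
    using no_two[of a c b] no_two[of c a b] that arcs_symmetric by (meson linorder_neqE_nat)
  have "parcs G = {(i, j). i < n \<and> j < n \<and> i \<noteq> j}"
  proof (intro equalityI subsetI)
    fix e assume "e \<in> parcs G"
    then show "e \<in> {(i, j). i < n \<and> j < n \<and> i \<noteq> j}"
      using arc_bounds no_loops' by (cases e) auto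
  next
    fix e assume "e \<in> {(i, j). i < n \<and> j < n \<and> i \<noteq> j}"
    then obtain i j where "e = (i, j)" "i < n" "j < n" "i \<noteq> j" by auto
    moreover have "i = j \<or> (i, j) \<in> parcs G"
      by (rule adjacent_if_no_distance_two[OF reach]) (use trans calculation in auto)
    ultimately show "e \<in> parcs G" by simp
  qed
  then have G: "G = complete_pair_graph n"
    using verts by (simp add: complete_pair_graph_def)
  \<comment> \<open>Since gains have modulus 1, row 0 shows that one constant normalizes all entries
    of \<open>v\<close>.\<close>
  have same: "norm (v $ i) = norm (v $ 0)" if "i < n" for i
  proof (cases "i = 0")
    case False
    then have "norm (gain 0 i) * norm (v $ i) = norm (v $ 0)"
      using arg_cong[OF gain[of 0 i], of norm] that n_pos by (simp add: norm_mult)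
    then show ?thesis using norm_gain[of 0 i] that False by simp
  qed simp
  \<comment> \<open>Switching inverts \<open>\<zeta>\<close> at the tail, while \<open>phi\<close>
    has \<open>v $ a\<close> there as numerator; hence the inverse of the normalized entry. The
    common norm cancels along each arc.\<close>
  define \<zeta> where "\<zeta> i = inverse (v $ i / of_real (norm (v $ 0)))" for i
  have "norm (\<zeta> i) = 1" if "i < n" for i
    using same[OF that] nz[OF n_pos] by (simp add: \<zeta>_def norm_divide norm_inverse)
  moreover have "\<phi> (a, b) = inverse (\<zeta> a) * (- 1) * \<zeta> b" if "(a, b) \<in> parcs G" for a b
    using phi[OF that] nz[OF n_pos] by (simp add: \<zeta>_def field_simps)
  ultimately have "(\<forall>i\<in>pverts G. norm (\<zeta> i) = 1) \<and>
      (\<forall>(a, b)\<in>parcs G. \<phi> (a, b) = inverse (\<zeta> a) * (- 1) * \<zeta> b)"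
    using verts by auto
  with G show ?thesis unfolding switching_equivalent_def by blast
qed

section \<open>The converse: an explicit eigenvector attains the bound\<close>

lemma extremal_if_switching_equivalent:
  assumes "switching_equivalent G \<phi> (complete_pair_graph n) (\<lambda>_. -1)"
  shows "spectral_radius (dist_laplacian G \<phi>) = 2 * T"
proof -
  obtain \<zeta> where G: "G = complete_pair_graph n"
    and unit: "\<And>i. i < n \<Longrightarrow> norm (\<zeta> i) = 1"
    and phi: "\<And>a b. (a, b) \<in> parcs G \<Longrightarrow> \<phi> (a, b) = - (inverse (\<zeta> a) * \<zeta> b)"
    using assms verts unfolding switching_equivalent_def by fastforce
  have arcs: "(i, j) \<in> parcs G" if "i < n" "j < n" "i \<noteq> j" for i j
    using that by (subst G) (simp add: complete_pair_graph_def)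
  have nz: "\<zeta> i \<noteq> 0" if "i < n" for i using unit[OF that] by auto
  have D: "D i j = (if i = j then 0 else - (inverse (\<zeta> i) * \<zeta> j))" if "i < n" "j < n" for i j
    using D_arc[OF arcs[OF that]] phi[OF arcs[OF that]] by (auto simp: D_def gain_max_def)
  \<comment> \<open>The transmission is read off as an absolute row sum of \<open>D\<close>, whose
    off-diagonal entries have modulus 1.\<close>
  have Tr: "real (transmission G i) = real n - 1" if "i < n" for i
  proof -
    have "real (transmission G i) = (\<Sum>j<n. if i = j then 0 else 1)"
      unfolding sum_norm_D[OF that, symmetric]
      by (rule sum.cong) (auto simp: D that norm_mult norm_inverse unit)
    also have "\<dots> = (\<Sum>j<n. 1 - (if i = j then 1 else 0))"
      by (rule sum.cong) auto
    also have "\<dots> = real n - 1" using that by (simp add: sum_subtractf)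
    finally show ?thesis .
  qed
  have T: "T = real n - 1"
  proof -
    have "Max (transmission G ` pverts G) \<in> transmission G ` pverts G"
      using n_pos verts by (intro Max_in) auto
    then show ?thesis using Tr verts by force
  qed
  \<comment> \<open>For j \<noteq> i one has
    \<open>- D i j * inverse (\<zeta> j) = inverse (\<zeta> i)\<close>, so the off-diagonal terms
    add up to n - 1 copies of \<open>inverse (\<zeta> i)\<close>, as many as the diagonal term
    gives.\<close>
  have "eigenvector (dist_laplacian G \<phi>) (vec n (\<lambda>i. inverse (\<zeta> i))) (of_real (2 * T))"
    unfolding dist_laplacian_eq
  proof (rule eigenvector_matI)
    fix i assume i: "i < n"
    have "(\<Sum>j<n. (case (i, j) of (i, j) \<Rightarrow>
          (if i = j then of_real (real (transmission G i)) else 0) - D i j) * inverse (\<zeta> j)) =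
        (\<Sum>j<n. inverse (\<zeta> i) + (if i = j then (of_nat n - 2) * inverse (\<zeta> i) else 0))"
      by (rule sum.cong) (auto simp: D Tr nz i algebra_simps)
    also have "\<dots> = of_real (2 * T) * inverse (\<zeta> i)"
      using i by (simp add: sum.distrib T algebra_simps)
    finally show "(\<Sum>j<n. (case (i, j) of (i, j) \<Rightarrow>
          (if i = j then of_real (real (transmission G i)) else 0) - D i j) * inverse (\<zeta> j)) =
        of_real (2 * T) * inverse (\<zeta> i)" .
  qed (use nz n_pos in auto)
  then have "norm (complex_of_real (2 * T)) \<in> norm ` spectrum (dist_laplacian G \<phi>)"
    unfolding spectrum_def eigenvalue_def by blast
  then have "norm (complex_of_real (2 * T)) \<le> spectral_radius (dist_laplacian G \<phi>)"
    by (rule spectral_radius_mem_max(2)[OF dist_laplacian_carrier n_pos])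
  then have "2 * T \<le> spectral_radius (dist_laplacian G \<phi>)"
    by (simp only: norm_of_real)
  then show ?thesis using spectral_radius_le by linarith
qed

end

theorem theorem4p5:
  fixes G :: "nat pair_pre_digraph" and \<phi> :: "nat \<times> nat \<Rightarrow> complex" and n :: nat
  assumes "gain_graph G \<phi>"
    and "pverts G = {0..<n}"
    and "Digraph_Component.connected (with_proj G)"
    and "distance_compatible G \<phi>"
  shows "spectral_radius (dist_laplacian G \<phi>) \<le> 2 * real (Max (transmission G ` pverts G)) \<and>
    (spectral_radius (dist_laplacian G \<phi>) = 2 * real (Max (transmission G ` pverts G)) \<longleftrightarrow>
      switching_equivalent G \<phi> (complete_pair_graph n) (\<lambda>_. -1))"
proof -
  interpret gain_graph G \<phi> by fact
  interpret compatible_gain_graph G \<phi> n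
    using assms by unfold_locales
  show ?thesis
    using spectral_radius_le switching_equivalent_if_extremal extremal_if_switching_equivalent
    by blast
qed

end
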